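(* Let $\alpha,\beta$ be coprime positive integers. Then each of the following numbers (1) the number of isomorphism classes of $\langle\alpha,\beta\rangle$-semimodules, (2) the number of $\langle\alpha,\beta\rangle$-lean sets, (3) the number of lattice paths from $(0,\alpha)$ to $(\beta,0)$ staying below the diagonal, equals \[ L_{\alpha,\beta}:=\sum_{r\ge0}L_{\alpha,\beta}(r)=\frac{1}{\alpha+\beta}\binom{\alpha+\beta}{\alpha},\qquad\text{where } L_{\alpha,\beta}(r)=\frac{1}{r+1}\binom{\alpha-1}{r}\binom{\beta-1}{r}. \]
   Context: $\mathbb N$ contains $0$. $\Gamma=\langle\alpha,\beta\rangle=\{a\alpha+b\beta\mid a,b\in\mathbb N\}$. A $\Gamma$-semimodule is a non-empty subset $\Delta\subseteq\mathbb N$ with $\Delta+\Gamma\subseteq\Delta$. Semimodules $\Delta,\Delta'$ are isomorphic if $x\mapsto x+c$ is a bijection $\Delta\to\Delta'$ for some integer $c$. A set $\{x_0=0,x_1,\dots,x_n\}\subseteq\mathbb N$ is $\Gamma$-lean if $|x_i-x_j|\notin\Gamma$ for $0\le i<j\le n$. Lattice paths from $(0,\alpha)$ to $(\beta,0)$ consist of unit steps downwards $(0,-1)$ and to the right $(1,0)$. The diagonal is the segment from $(0,\alpha)$ to $(\beta,0)$; a path stays below the diagonal if all its points $(x,y)$ satisfy $\alpha x+\beta y\le\alpha\beta$. *)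

theory Defs
  imports Complex_Main
begin

definition gen_semigroup :: "nat \<Rightarrow> nat \<Rightarrow> nat set" where
  "gen_semigroup \<alpha> \<beta> = {a * \<alpha> + b * \<beta> | a b. True}"


subsection \<open>Semimodules and their isomorphism classes\<close>

definition semimodule :: "nat set \<Rightarrow> nat set \<Rightarrow> bool" where
  "semimodule \<Gamma> \<Delta> \<longleftrightarrow> \<Delta> \<noteq> {} \<and> (\<forall>x\<in>\<Delta>. \<forall>g\<in>\<Gamma>. x + g \<in> \<Delta>)"

text \<open>The shift may be negative, so both sets are embedded into the integers.\<close>

definition semimodule_iso :: "nat set \<Rightarrow> nat set \<Rightarrow> bool" where
  "semimodule_iso \<Delta> \<Delta>' \<longleftrightarrow> (\<exists>c::int. bij_betw (\<lambda>x. x + c) (int ` \<Delta>) (int ` \<Delta>'))"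

definition semimodule_iso_rel :: "nat set \<Rightarrow> (nat set \<times> nat set) set" where
  "semimodule_iso_rel \<Gamma> =
     {(\<Delta>, \<Delta>'). semimodule \<Gamma> \<Delta> \<and> semimodule \<Gamma> \<Delta>' \<and> semimodule_iso \<Delta> \<Delta>'}"

definition semimodule_iso_classes :: "nat set \<Rightarrow> nat set set set" where
  "semimodule_iso_classes \<Gamma> = {\<Delta>. semimodule \<Gamma> \<Delta>} // semimodule_iso_rel \<Gamma>"

lemma equiv_semimodule_iso_rel: "equiv {\<Delta>. semimodule \<Gamma> \<Delta>} (semimodule_iso_rel \<Gamma>)"
proof (rule equivI)
  show "semimodule_iso_rel \<Gamma> \<subseteq> {\<Delta>. semimodule \<Gamma> \<Delta>} \<times> {\<Delta>. semimodule \<Gamma> \<Delta>}"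
    by (auto simp: semimodule_iso_rel_def)
  have "semimodule_iso \<Delta> \<Delta>" for \<Delta>
    unfolding semimodule_iso_def by (rule exI[of _ 0]) (simp add: bij_betw_def)
  then show "refl_on {\<Delta>. semimodule \<Gamma> \<Delta>} (semimodule_iso_rel \<Gamma>)"
    by (auto simp: refl_on_def semimodule_iso_rel_def)
  have "semimodule_iso \<Delta>' \<Delta>" if "semimodule_iso \<Delta> \<Delta>'" for \<Delta> \<Delta>'
  proof -
    obtain c where c: "(\<lambda>x. x + c) ` (int ` \<Delta>) = int ` \<Delta>'"
      using \<open>semimodule_iso \<Delta> \<Delta>'\<close> by (auto simp: semimodule_iso_def bij_betw_def)
    have "(\<lambda>x. x + (- c)) ` (int ` \<Delta>') = int ` \<Delta>"
      unfolding c[symmetric] by (simp add: image_image)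
    then show ?thesis
      unfolding semimodule_iso_def bij_betw_def
      by (intro exI[of _ "- c"]) (simp add: inj_on_def)
  qed
  then show "sym (semimodule_iso_rel \<Gamma>)"
    by (auto simp: sym_def semimodule_iso_rel_def)
  have trans: "semimodule_iso A C" if AB: "semimodule_iso A B" and BC: "semimodule_iso B C" for A B C
  proof -
    obtain c d where c: "(\<lambda>x. x + c) ` (int ` A) = int ` B"
        and d: "(\<lambda>x. x + d) ` (int ` B) = int ` C"
      using AB BC by (force simp: semimodule_iso_def bij_betw_def)
    have "(\<lambda>x. x + (c + d)) ` (int ` A) = int ` C"
      unfolding d[symmetric] c[symmetric] by (simp add: image_image add.assoc)
    then show ?thesis
      unfolding semimodule_iso_def bij_betw_def
      by (intro exI[of _ "c + d"]) (simp add: inj_on_def)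
  qed
  show "trans (semimodule_iso_rel \<Gamma>)"
    by (auto simp: trans_def semimodule_iso_rel_def intro: trans)
qed


subsection \<open>Lean sets\<close>

text \<open>
  Since \<open>0 \<in> \<Gamma>\<close>, the condition on an enumeration \<open>x\<^sub>0, \<dots>, x\<^sub>n\<close> forces its entries to be
  distinct, so it can be stated for pairs of distinct elements of the set.
\<close>

definition lean_set :: "nat set \<Rightarrow> nat set \<Rightarrow> bool" where
  "lean_set \<Gamma> A \<longleftrightarrow> finite A \<and> 0 \<in> A \<and>
     (\<forall>x\<in>A. \<forall>y\<in>A. x \<noteq> y \<longrightarrow> nat \<bar>int x - int y\<bar> \<notin> \<Gamma>)"


subsection \<open>Lattice paths\<close>

definition path_step :: "int \<times> int \<Rightarrow> int \<times> int \<Rightarrow> bool" where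
  "path_step p q \<longleftrightarrow>
     q = (fst p, snd p - 1) \<or> q = (fst p + 1, snd p)"

text \<open>A lattice path is the list of the lattice points it visits.\<close>

definition lattice_path :: "int \<times> int \<Rightarrow> int \<times> int \<Rightarrow> (int \<times> int) list \<Rightarrow> bool" where
  "lattice_path p q ps \<longleftrightarrow>
     ps \<noteq> [] \<and> hd ps = p \<and> last ps = q \<and> successively path_step ps"

text \<open>
  The condition is affine, so holding at the lattice points of a path it holds along the
  unit segments as well.
\<close>

definition below_diagonal :: "nat \<Rightarrow> nat \<Rightarrow> (int \<times> int) list \<Rightarrow> bool" where
  "below_diagonal \<alpha> \<beta> ps \<longleftrightarrow>
     (\<forall>(x, y)\<in>set ps. int \<alpha> * x + int \<beta> * y \<le> int \<alpha> * int \<beta>)"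


subsection \<open>The numbers\<close>

definition L_term :: "nat \<Rightarrow> nat \<Rightarrow> nat \<Rightarrow> real" where
  "L_term \<alpha> \<beta> r = 1 / real (r + 1) * real ((\<alpha> - 1) choose r) * real ((\<beta> - 1) choose r)"

definition L_total :: "nat \<Rightarrow> nat \<Rightarrow> real" where
  "L_total \<alpha> \<beta> = (\<Sum>r. L_term \<alpha> \<beta> r)"

lemma L_term_sums_L_total: "L_term \<alpha> \<beta> sums L_total \<alpha> \<beta>"
proof -
  have "L_term \<alpha> \<beta> r = 0" if "r \<notin> {..\<alpha>}" for r
    using that by (simp add: L_term_def binomial_eq_0)
  then have "summable (L_term \<alpha> \<beta>)"
    by (intro summable_finite[of "{..\<alpha>}"]) auto
  then show ?thesis
    unfolding L_total_def by (rule summable_sums)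
qed

end

theory Submission
  imports Defs "HOL-Combinatorics.Multiset_Permutations" "HOL-Number_Theory.Cong"
begin

text \<open>
  Label the lattice point \<open>(x, y)\<close> by \<open>\<alpha> \<beta> - \<alpha> x - \<beta> y\<close>. A path from \<open>(0, \<alpha>)\<close> to \<open>(\<beta>, 0)\<close>
  stays below the diagonal iff all its labels are nonnegative. As \<open>\<alpha>\<close> and \<open>\<beta>\<close> are coprime, the
  \<open>\<alpha> + \<beta>\<close> labels along one period of a cyclic step sequence are distinct, so exactly one of its
  rotations stays below the diagonal; this gives the closed form, which equals the sum by
  Vandermonde's identity. The labels of a path generate a semimodule with minimum \<open>0\<close>, and the path
  is recovered as the boundary walk that steps to the right whenever the label there still belongs to
  the semimodule. Every isomorphism class contains exactly one semimodule with minimum \<open>0\<close>, and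
  the minimal generators of such semimodules are exactly the lean sets.
\<close>

section \<open>The closed form\<close>

text \<open>Multiplying by \<alpha> absorbs the factor 1/(r+1) into
  \<open>\<alpha> choose Suc r\<close>. The sum becomes a Vandermonde convolution with value
  \<open>(\<alpha> + b) choose \<beta>\<close>, and a second absorption brings in the factor
  \<alpha> + \<beta>.\<close>

lemma L_total_closed_form:
  assumes "\<alpha> > 0" "\<beta> > 0"
  shows "L_total \<alpha> \<beta> = 1 / real (\<alpha> + \<beta>) * real ((\<alpha> + \<beta>) choose \<alpha>)"
proof -
  obtain a b where ab: "\<alpha> = Suc a" "\<beta> = Suc b"
    using assms by (metis Suc_pred)
  have absorb: "real \<alpha> * L_term \<alpha> \<beta> r = real (\<alpha> choose Suc r) * real (b choose r)" for r
  proof -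
    have "real \<alpha> * real (a choose r) = real (\<alpha> choose Suc r) * real (r + 1)"
      using Suc_times_binomial_eq[of a r] by (simp only: ab Suc_eq_plus1 flip: of_nat_mult)
    then show ?thesis
      by (simp add: L_term_def ab divide_eq_eq mult.commute mult.left_commute del: binomial_Suc_Suc)
  qed
  have "L_total \<alpha> \<beta> = (\<Sum>r\<le>b. L_term \<alpha> \<beta> r)"
    unfolding L_total_def by (rule suminf_finite) (auto simp: L_term_def ab binomial_eq_0)
  then have "real \<alpha> * L_total \<alpha> \<beta> = real (\<Sum>r\<le>b. (\<alpha> choose Suc r) * (b choose r))"
    by (simp add: sum_distrib_left absorb)
  also have "(\<Sum>r\<le>b. (\<alpha> choose Suc r) * (b choose r)) =
      (\<Sum>r\<le>b. (\<alpha> choose Suc r) * (b choose (\<beta> - Suc r)))"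
    by (rule sum.cong) (simp_all add: ab flip: binomial_symmetric)
  \<comment> \<open>The added term k = 0 vanishes because \<open>b choose \<beta>\<close> is 0 for
    \<beta> = b + 1.\<close>
  also have "\<dots> = (\<Sum>k\<le>\<beta>. (\<alpha> choose k) * (b choose (\<beta> - k)))"
    by (simp add: ab sum.atMost_Suc_shift del: sum.atMost_Suc binomial_Suc_Suc)
  also have "\<dots> = (\<alpha> + b) choose \<beta>"
    by (rule vandermonde)
  finally have L: "real \<alpha> * L_total \<alpha> \<beta> = real ((\<alpha> + b) choose \<beta>)" .
  have "(\<alpha> + \<beta>) choose \<alpha> = (\<alpha> + \<beta>) choose \<beta>"
    using binomial_symmetric[of \<alpha> "\<alpha> + \<beta>"] by simp
  moreover have "\<alpha> * ((\<alpha> + \<beta>) choose \<beta>) = (\<alpha> + \<beta>) * ((\<alpha> + b) choose \<beta>)"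
    using binomial_absorb_comp[of "\<alpha> + \<beta>" \<beta>] by (simp add: ab)
  ultimately have "real \<alpha> * real ((\<alpha> + \<beta>) choose \<alpha>) = real (\<alpha> + \<beta>) * (real \<alpha> * L_total \<alpha> \<beta>)"
    unfolding L by (metis of_nat_mult)
  then have "real ((\<alpha> + \<beta>) choose \<alpha>) = real (\<alpha> + \<beta>) * L_total \<alpha> \<beta>"
    using assms(1) by (simp add: mult.left_commute)
  then show ?thesis
    using assms(1) by simp
qed


section \<open>Ballot words and the cycle lemma\<close>

text \<open>
  A word encodes a path, \<open>True\<close> being a downward step and \<open>False\<close> a step to the right. The weight
  of a prefix is the value of \<open>\<alpha> \<beta> - \<alpha> x - \<beta> y\<close> at the point it leads to.
\<close>

definition weight :: "nat \<Rightarrow> nat \<Rightarrow> bool list \<Rightarrow> int" where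
  "weight \<alpha> \<beta> w = int \<beta> * int (count_list w True) - int \<alpha> * int (count_list w False)"

definition step_words :: "nat \<Rightarrow> nat \<Rightarrow> bool list set" where
  "step_words \<alpha> \<beta> = {w. count_list w True = \<alpha> \<and> count_list w False = \<beta>}"

definition ballot_words :: "nat \<Rightarrow> nat \<Rightarrow> bool list set" where
  "ballot_words \<alpha> \<beta> = {w \<in> step_words \<alpha> \<beta>. \<forall>k. 0 \<le> weight \<alpha> \<beta> (take k w)}"

lemma count_list_True_False: "count_list w True + count_list w False = length w"
  by (induction w) auto

lemma length_step_words: "w \<in> step_words \<alpha> \<beta> \<Longrightarrow> length w = \<alpha> + \<beta>"
  using count_list_True_False[of w] by (simp add: step_words_def)

lemma weight_append [simp]: "weight \<alpha> \<beta> (u @ v) = weight \<alpha> \<beta> u + weight \<alpha> \<beta> v"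
  by (simp add: weight_def algebra_simps)

lemma weight_Nil [simp]: "weight \<alpha> \<beta> [] = 0"
  by (simp add: weight_def)

lemma weight_step_words [simp]: "w \<in> step_words \<alpha> \<beta> \<Longrightarrow> weight \<alpha> \<beta> w = 0"
  by (simp add: weight_def step_words_def)

lemma weight_eq: "weight \<alpha> \<beta> w = int (\<alpha> + \<beta>) * int (count_list w True) - int \<alpha> * int (length w)"
  unfolding weight_def count_list_True_False[of w, symmetric] by (simp add: algebra_simps)

text \<open>Gives access to the finiteness and the cardinality of multiset permutations.\<close>

lemma step_words_eq_permutations:
  "step_words \<alpha> \<beta> =
    permutations_of_multiset (replicate_mset \<alpha> True + replicate_mset \<beta> False)"
  by (auto simp: step_words_def permutations_of_multiset_def multiset_eq_iff count_mset
      all_bool_eq)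

lemma finite_step_words: "finite (step_words \<alpha> \<beta>)"
  by (simp add: step_words_eq_permutations)

lemma card_step_words: "card (step_words \<alpha> \<beta>) = (\<alpha> + \<beta>) choose \<alpha>"
proof -
  let ?A = "replicate_mset \<alpha> True + replicate_mset \<beta> False"
  \<comment> \<open>Extending the product to both letters covers \<alpha> = 0 and \<beta> = 0 as
    well: an absent letter contributes \<open>fact 0 = 1\<close>.\<close>
  have "(\<Prod>x\<in>set_mset ?A. fact (count ?A x)) = (\<Prod>x\<in>UNIV. fact (count ?A x) :: nat)"
    by (rule prod.mono_neutral_left) (auto simp: not_in_iff)
  then have "card (step_words \<alpha> \<beta>) = fact (\<alpha> + \<beta>) div (fact \<alpha> * fact \<beta>)"
    by (simp add: step_words_eq_permutations card_permutations_of_multiset UNIV_bool mult.commute)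
  then show ?thesis
    by (simp add: binomial_fact')
qed

text \<open>By \<open>weight_eq\<close>, equal weights make \<alpha> + \<beta> divide \<alpha> (i -
  j). It is coprime to \<alpha>, hence divides i - j, whose absolute value is smaller.\<close>

lemma weight_take_inj:
  assumes "coprime \<alpha> \<beta>" "length v = \<alpha> + \<beta>" "i < \<alpha> + \<beta>" "j < \<alpha> + \<beta>"
    and "weight \<alpha> \<beta> (take i v) = weight \<alpha> \<beta> (take j v)"
  shows "i = j"
proof -
  have "int (\<alpha> + \<beta>) * (int (count_list (take i v) True) - int (count_list (take j v) True))
      = int \<alpha> * (int i - int j)"
    using assms by (simp add: weight_eq algebra_simps)
  then have "int (\<alpha> + \<beta>) dvd int \<alpha> * (int i - int j)"
    by (metis dvd_triv_left)
  moreover have "coprime (int (\<alpha> + \<beta>)) (int \<alpha>)"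
    using assms(1) by (simp add: coprime_iff_gcd_eq_1 gcd.commute)
  ultimately have "int (\<alpha> + \<beta>) dvd int i - int j"
    by (simp add: coprime_dvd_mult_right_iff)
  then show ?thesis
    using assms(3,4) zdvd_imp_le[of "int (\<alpha> + \<beta>)" "int i - int j"]
      zdvd_imp_le[of "int (\<alpha> + \<beta>)" "int j - int i"]
    by (cases i j rule: linorder_cases) (auto simp: dvd_diff_commute)
qed

text \<open>As the whole word has weight 0, starting at the end of \<open>x\<close> subtracts the
  weight of \<open>x\<close> from all prefix weights. So a rotation is ballot exactly if the cut is
  made at a minimum.\<close>

lemma ballot_rotation_iff:
  assumes "weight \<alpha> \<beta> (x @ y) = 0"
  shows "(\<forall>k. 0 \<le> weight \<alpha> \<beta> (take k (y @ x))) \<longleftrightarrow>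
    (\<forall>k. weight \<alpha> \<beta> x \<le> weight \<alpha> \<beta> (take k (x @ y)))"
proof (intro iffI allI)
  fix k
  assume *: "\<forall>k. 0 \<le> weight \<alpha> \<beta> (take k (y @ x))"
  show "weight \<alpha> \<beta> x \<le> weight \<alpha> \<beta> (take k (x @ y))"
  proof (cases "k \<le> length x")
    case True
    then show ?thesis
      using *[rule_format, of "length y + k"] assms by simp
  next
    \<comment> \<open>The minimum below keeps the instantiated prefix inside \<open>y\<close> when k
      exceeds the total length.\<close>
    case False
    then show ?thesis
      using *[rule_format, of "min (length y) (k - length x)"] by (auto simp: min_def split: if_splits)
  qed
next
  fix k
  assume *: "\<forall>k. weight \<alpha> \<beta> x \<le> weight \<alpha> \<beta> (take k (x @ y))"
  show "0 \<le> weight \<alpha> \<beta> (take k (y @ x))"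
  proof (cases "k \<le> length y")
    case True
    then show ?thesis
      using *[rule_format, of "length x + k"] assms by simp
  next
    case False
    then show ?thesis
      using *[rule_format, of "min (length x) (k - length y)"] assms
      by (auto simp: min_def split: if_splits)
  qed
qed

lemma count_list_rotate [simp]: "count_list (rotate p v) b = count_list v b"
proof -
  have "count_list (rotate p v) b =
      count_list (take (p mod length v) v @ drop (p mod length v) v) b"
    unfolding rotate_drop_take count_list_append by simp
  then show ?thesis
    by (simp del: count_list_append)
qed

lemma rotate_in_step_words [simp]: "rotate p v \<in> step_words \<alpha> \<beta> \<longleftrightarrow> v \<in> step_words \<alpha> \<beta>"
  by (simp add: step_words_def)

text \<open>
  The ballot rotation starts at the minimum of the prefix weights, which is unique because
  \<open>weight_eq\<close> determines these weights modulo \<open>\<alpha> + \<beta>\<close> by the position.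
\<close>

lemma cycle_lemma_ex1:
  assumes "coprime \<alpha> \<beta>" "\<alpha> > 0" "v \<in> step_words \<alpha> \<beta>"
  shows "\<exists>!p. p < \<alpha> + \<beta> \<and> rotate p v \<in> ballot_words \<alpha> \<beta>"
proof -
  have len: "length v = \<alpha> + \<beta>"
    using assms(3) by (rule length_step_words)
  have iff: "rotate p v \<in> ballot_words \<alpha> \<beta> \<longleftrightarrow>
      (\<forall>k. weight \<alpha> \<beta> (take p v) \<le> weight \<alpha> \<beta> (take k v))" if "p < \<alpha> + \<beta>" for p
  proof -
    have "rotate p v = drop p v @ take p v"
      using that by (simp add: rotate_drop_take len)
    then show ?thesis
      using ballot_rotation_iff[of \<alpha> \<beta> "take p v" "drop p v"] assms(3)
      by (simp add: ballot_words_def del: weight_append take_append flip: rotate_in_step_words[of p v])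
  qed
  let ?f = "\<lambda>k. weight \<alpha> \<beta> (take k v)"
  have "\<exists>p\<in>{..<\<alpha> + \<beta>}. \<forall>k\<in>{..<\<alpha> + \<beta>}. ?f p \<le> ?f k"
    using ex_min_if_finite[of "?f ` {..<\<alpha> + \<beta>}"] assms(2) by (fastforce simp: not_less)
  then obtain p where p: "p < \<alpha> + \<beta>" "\<And>k. k < \<alpha> + \<beta> \<Longrightarrow> ?f p \<le> ?f k"
    by auto
  have min: "?f p \<le> ?f k" for k
  proof (cases "k < \<alpha> + \<beta>")
    \<comment> \<open>Such a prefix is the whole word; its weight 0 is also that of the empty
      prefix.\<close>
    case False
    then show ?thesis
      using p(2)[of 0] assms(2,3) by (simp add: len)
  qed (use p in auto)
  show ?thesis
  proof (rule ex1I[of _ p])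
    show "p < \<alpha> + \<beta> \<and> rotate p v \<in> ballot_words \<alpha> \<beta>"
      using p(1) min by (simp add: iff)
    fix q
    assume q: "q < \<alpha> + \<beta> \<and> rotate q v \<in> ballot_words \<alpha> \<beta>"
    then have "?f q = ?f p"
      using min[of q] iff[of q] by (simp add: antisym)
    then show "q = p"
      using weight_take_inj[OF assms(1) len] q p(1) by blast
  qed
qed

text \<open>Sorting the step words by the unique p of \<open>cycle_lemma_ex1\<close> gives \<alpha>
  + \<beta> disjoint classes \<open>?R p\<close>, each mapped bijectively onto the ballot words by
  \<open>rotate p\<close>.\<close>

lemma card_ballot_words:
  assumes "coprime \<alpha> \<beta>" "\<alpha> > 0"
  shows "(\<alpha> + \<beta>) * card (ballot_words \<alpha> \<beta>) = (\<alpha> + \<beta>) choose \<alpha>"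
proof -
  let ?W = "step_words \<alpha> \<beta>" and ?B = "ballot_words \<alpha> \<beta>"
  let ?R = "\<lambda>p. {v \<in> ?W. rotate p v \<in> ?B}"
  have inj: "inj_on (rotate p) X" for p and X :: "bool list set"
    by (rule inj_on_subset[OF _ subset_UNIV]) (simp add: rotate_def inj_fn inj_rotate1)
  have "card (?R p) = card ?B" for p
  proof -
    have "rotate p ` ?W = ?W"
      by (rule endo_inj_surj[OF finite_step_words _ inj]) auto
    moreover have "?B \<subseteq> ?W"
      by (auto simp: ballot_words_def)
    ultimately have "w \<in> rotate p ` ?R p" if "w \<in> ?B" for w
      using that by (smt (verit) image_iff mem_Collect_eq subset_iff)
    then have "rotate p ` ?R p = ?B"
      by auto
    then show ?thesis
      using card_image[OF inj] by metis
  qed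
  moreover have "?W = (\<Union>p\<in>{..<\<alpha> + \<beta>}. ?R p)"
    using cycle_lemma_ex1[OF assms] by blast
  moreover have "card (\<Union>p\<in>{..<\<alpha> + \<beta>}. ?R p) = (\<Sum>p\<in>{..<\<alpha> + \<beta>}. card (?R p))"
    by (rule card_UN_disjoint) (use cycle_lemma_ex1[OF assms] finite_step_words in \<open>simp_all, blast\<close>)
  ultimately have "card ?W = (\<alpha> + \<beta>) * card ?B"
    by simp
  then show ?thesis
    by (simp add: card_step_words)
qed


section \<open>Lattice paths\<close>

primrec walk :: "int \<times> int \<Rightarrow> bool list \<Rightarrow> (int \<times> int) list" where
  "walk p [] = [p]"
| "walk p (b # w) = p # walk (if b then (fst p, snd p - 1) else (fst p + 1, snd p)) w"

definition walk_end :: "int \<times> int \<Rightarrow> bool list \<Rightarrow> int \<times> int" where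
  "walk_end p w = (fst p + int (count_list w False), snd p - int (count_list w True))"

lemma walk_neq_Nil [simp]: "walk p w \<noteq> []"
  by (cases w) auto

lemma hd_walk [simp]: "hd (walk p w) = p"
  by (cases w) auto

lemma last_walk [simp]: "last (walk p w) = walk_end p w"
  by (induction w arbitrary: p) (auto simp: walk_end_def)

lemma walk_inj: "walk p u = walk p v \<longleftrightarrow> u = v"
proof (induction u arbitrary: p v)
  case Nil
  then show ?case by (cases v) (auto dest: sym)
next
  case (Cons b u)
  show ?case
  proof (cases v)
    case (Cons c v')
    have "b = c" if "walk (if b then (fst p, snd p - 1) else (fst p + 1, snd p)) u =
        walk (if c then (fst p, snd p - 1) else (fst p + 1, snd p)) v'"
      using arg_cong[OF that, of hd] by (auto split: if_splits)
    then show ?thesis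
      using Cons.IH by (auto simp: Cons)
  qed auto
qed

lemma set_walk: "set (walk p w) = range (\<lambda>k. walk_end p (take k w))"
proof (induction w arbitrary: p)
  case Nil
  then show ?case by (simp add: walk_end_def)
next
  case (Cons b w)
  let ?q = "if b then (fst p, snd p - 1) else (fst p + 1, snd p)"
  \<comment> \<open>Index 0 stands for the empty prefix, the successors for the prefixes starting
    with \<open>b\<close>.\<close>
  have "(UNIV :: nat set) = insert 0 (range Suc)"
    using not0_implies_Suc by blast
  then have "range f = insert (f 0) (range (\<lambda>k. f (Suc k)))" for f :: "nat \<Rightarrow> int \<times> int"
    by (metis image_image image_insert)
  from this[of "\<lambda>k. walk_end p (take k (b # w))"]
  have "range (\<lambda>k. walk_end p (take k (b # w))) =
      insert (walk_end p []) (range (\<lambda>k. walk_end p (b # take k w)))"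
    by simp
  moreover have "walk_end p (b # u) = walk_end ?q u" for u
    by (simp add: walk_end_def)
  ultimately show ?case
    by (simp add: Cons.IH) (simp add: walk_end_def)
qed

lemma successively_path_step_walk: "successively path_step (walk p w)"
  by (induction w arbitrary: p) (auto simp: successively_Cons path_step_def)

text \<open>The word is read off from the head of the list; with
  \<open>successively_path_step_walk\<close> this identifies lattice paths with words.\<close>

lemma successively_path_step_ex_walk:
  "successively path_step ps \<Longrightarrow> ps \<noteq> [] \<Longrightarrow> \<exists>w. ps = walk (hd ps) w"
proof (induction ps rule: induct_list012)
  case (2 p)
  then show ?case by (intro exI[of _ "[]"]) simp
next
  case (3 p q ps)
  then obtain w where w: "q # ps = walk q w"
    by auto
  have "path_step p q"
    using 3 by simp
  then consider "q = (fst p, snd p - 1)" | "q = (fst p + 1, snd p)"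
    by (auto simp: path_step_def)
  then show ?case
  proof cases
    case 1
    then show ?thesis using w by (intro exI[of _ "True # w"]) simp
  next
    case 2
    then show ?thesis using w by (intro exI[of _ "False # w"]) simp
  qed
qed simp

lemma lattice_path_iff_walk: "lattice_path p q ps \<longleftrightarrow> (\<exists>w. ps = walk p w \<and> walk_end p w = q)"
  unfolding lattice_path_def
  by (metis hd_walk last_walk successively_path_step_ex_walk successively_path_step_walk walk_neq_Nil)

text \<open>A prefix with D steps down and R to the right ends at (R, \<alpha> - D), where \<alpha>
  \<beta> - \<alpha> R - \<beta> (\<alpha> - D) = \<beta> D - \<alpha> R is its weight.\<close>

lemma below_diagonal_walk_iff:
  "below_diagonal \<alpha> \<beta> (walk (0, int \<alpha>) w) \<longleftrightarrow> (\<forall>k. 0 \<le> weight \<alpha> \<beta> (take k w))"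
  by (simp add: below_diagonal_def set_walk walk_end_def weight_def algebra_simps)

lemma card_lattice_paths_below:
  "card {ps. lattice_path (0, int \<alpha>) (int \<beta>, 0) ps \<and> below_diagonal \<alpha> \<beta> ps} =
    card (ballot_words \<alpha> \<beta>)"
proof -
  have "{ps. lattice_path (0, int \<alpha>) (int \<beta>, 0) ps \<and> below_diagonal \<alpha> \<beta> ps} =
      walk (0, int \<alpha>) ` ballot_words \<alpha> \<beta>"
    by (auto simp: lattice_path_iff_walk below_diagonal_walk_iff ballot_words_def step_words_def
        walk_end_def)
  moreover have "inj_on (walk (0, int \<alpha>)) (ballot_words \<alpha> \<beta>)"
    by (simp add: inj_on_def walk_inj)
  ultimately show ?thesis
    by (simp add: card_image)
qed


section \<open>Semimodules\<close>

text \<open>The image of 0 shows that the shift is nonnegative, the preimage of 0 that it is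
  nonpositive.\<close>

lemma semimodule_iso_normalized:
  assumes "semimodule_iso \<Delta> \<Delta>'" "0 \<in> \<Delta>" "0 \<in> \<Delta>'"
  shows "\<Delta> = \<Delta>'"
proof -
  obtain c where c: "(\<lambda>x. x + c) ` (int ` \<Delta>) = int ` \<Delta>'"
    using assms(1) by (auto simp: semimodule_iso_def bij_betw_def)
  have "int 0 + c \<in> int ` \<Delta>'"
    using assms(2) unfolding c[symmetric] by blast
  moreover have "int 0 \<in> (\<lambda>x. x + c) ` (int ` \<Delta>)"
    using assms(3) unfolding c by blast
  ultimately have "c = 0"
    by auto
  then show ?thesis
    using c by (simp add: inj_image_eq_iff)
qed

text \<open>Shift down by the least element m. The shifted set is written as a preimage under adding
  m, which keeps truncated subtraction out of it.\<close>

lemma ex_normalized_semimodule_iso: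
  assumes "semimodule \<Gamma> \<Delta>"
  shows "\<exists>\<Delta>'. semimodule \<Gamma> \<Delta>' \<and> 0 \<in> \<Delta>' \<and> semimodule_iso \<Delta>' \<Delta>"
proof (intro exI conjI)
  define m where "m = (LEAST x. x \<in> \<Delta>)"
  let ?D = "{x. x + m \<in> \<Delta>}"
  obtain x where "x \<in> \<Delta>"
    using assms by (auto simp: semimodule_def)
  then have m: "m \<in> \<Delta>"
    unfolding m_def by (rule LeastI)
  have le: "m \<le> x" if "x \<in> \<Delta>" for x
    unfolding m_def using that by (rule Least_le)
  show zero: "0 \<in> ?D"
    using m by simp
  have "x + g + m \<in> \<Delta>" if "x + m \<in> \<Delta>" "g \<in> \<Gamma>" for x g
    using assms that by (auto simp: semimodule_def add.assoc add.commute[of g])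
  then show "semimodule \<Gamma> ?D"
    using zero unfolding semimodule_def by blast
  have "(\<lambda>x. x + int m) ` (int ` ?D) = int ` \<Delta>"
  proof (intro equalityI subsetI)
    fix y
    assume "y \<in> int ` \<Delta>"
    then obtain x where "y = int x" "x \<in> \<Delta>"
      by auto
    then show "y \<in> (\<lambda>x. x + int m) ` (int ` ?D)"
      using le[of x] by (intro image_eqI[of _ _ "int (x - m)"] imageI) auto
  qed (auto simp flip: of_nat_add)
  then show "semimodule_iso ?D \<Delta>"
    unfolding semimodule_iso_def bij_betw_def by (intro exI[of _ "int m"]) (simp add: inj_on_def)
qed

lemma card_semimodule_iso_classes:
  "card (semimodule_iso_classes \<Gamma>) = card {\<Delta>. semimodule \<Gamma> \<Delta> \<and> 0 \<in> \<Delta>}"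
proof -
  let ?r = "semimodule_iso_rel \<Gamma>" and ?N = "{\<Delta>. semimodule \<Gamma> \<Delta> \<and> 0 \<in> \<Delta>}"
  note eq = eq_equiv_class_iff[OF equiv_semimodule_iso_rel[of \<Gamma>], unfolded mem_Collect_eq]
  have "bij_betw (\<lambda>\<Delta>. ?r `` {\<Delta>}) ?N (semimodule_iso_classes \<Gamma>)"
  proof (rule bij_betw_imageI)
    show "inj_on (\<lambda>\<Delta>. ?r `` {\<Delta>}) ?N"
    proof (rule inj_onI)
      fix \<Delta> \<Delta>'
      assume "\<Delta> \<in> ?N" "\<Delta>' \<in> ?N" "?r `` {\<Delta>} = ?r `` {\<Delta>'}"
      then show "\<Delta> = \<Delta>'"
        using eq[of \<Delta> \<Delta>'] semimodule_iso_normalized[of \<Delta> \<Delta>']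
        by (simp add: semimodule_iso_rel_def)
    qed
    show "(\<lambda>\<Delta>. ?r `` {\<Delta>}) ` ?N = semimodule_iso_classes \<Gamma>"
    proof (intro equalityI subsetI)
      fix X
      assume "X \<in> semimodule_iso_classes \<Gamma>"
      then obtain \<Delta> where \<Delta>: "semimodule \<Gamma> \<Delta>" "X = ?r `` {\<Delta>}"
        by (auto simp: semimodule_iso_classes_def quotient_def)
      then obtain \<Delta>' where \<Delta>': "semimodule \<Gamma> \<Delta>'" "0 \<in> \<Delta>'" "semimodule_iso \<Delta>' \<Delta>"
        using ex_normalized_semimodule_iso by blast
      then have "?r `` {\<Delta>'} = ?r `` {\<Delta>}"
        using \<Delta> by (intro eq[THEN iffD2]) (simp_all add: semimodule_iso_rel_def)
      then show "X \<in> (\<lambda>\<Delta>. ?r `` {\<Delta>}) ` ?N"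
        using \<Delta> \<Delta>' by blast
    qed (auto simp: semimodule_iso_classes_def quotient_def)
  qed
  then show ?thesis
    by (rule bij_betw_same_card[symmetric])
qed

section \<open>Generated semimodules, minimal generators and lean sets\<close>

definition generated :: "nat set \<Rightarrow> nat set \<Rightarrow> nat set" where
  "generated \<Gamma> A = {a + g | a g. a \<in> A \<and> g \<in> \<Gamma>}"

lemma semimodule_generated:
  assumes "\<And>g h. g \<in> \<Gamma> \<Longrightarrow> h \<in> \<Gamma> \<Longrightarrow> g + h \<in> \<Gamma>" "\<Gamma> \<noteq> {}" "A \<noteq> {}"
  shows "semimodule \<Gamma> (generated \<Gamma> A)"
proof -
  have "a + g + h \<in> generated \<Gamma> A" if "a \<in> A" "g \<in> \<Gamma>" "h \<in> \<Gamma>" for a g h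
    using assms(1)[OF that(2,3)] that(1) by (auto simp: generated_def add.assoc)
  moreover have "generated \<Gamma> A \<noteq> {}"
    using assms(2,3) by (auto simp: generated_def)
  ultimately show ?thesis
    by (auto simp: semimodule_def generated_def)
qed

lemma generated_subset: "semimodule \<Gamma> \<Delta> \<Longrightarrow> A \<subseteq> \<Delta> \<Longrightarrow> generated \<Gamma> A \<subseteq> \<Delta>"
  unfolding semimodule_def generated_def by auto

lemma subset_generated: "0 \<in> \<Gamma> \<Longrightarrow> A \<subseteq> generated \<Gamma> A"
  unfolding generated_def by force

text \<open>A one-sided form of leanness, free of the absolute value.\<close>

lemma lean_setD:
  assumes "lean_set \<Gamma> A" "y + g \<in> A" "y \<in> A" "g \<in> \<Gamma>"
  shows "g = 0"
proof (rule ccontr)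
  assume "g \<noteq> 0"
  then have "nat \<bar>int (y + g) - int y\<bar> \<notin> \<Gamma>"
    using assms(1-3) unfolding lean_set_def by fastforce
  then show False
    using assms(4) by simp
qed

text \<open>Writing a = b + g and b = a' + g' gives a = a' + (g' + g), so leanness forces g = 0 and
  a = b. Used in both directions, this makes \<open>generated\<close> injective on lean
  sets.\<close>

lemma generated_lean_subset:
  assumes "\<And>g h. g \<in> \<Gamma> \<Longrightarrow> h \<in> \<Gamma> \<Longrightarrow> g + h \<in> \<Gamma>" "0 \<in> \<Gamma>"
    and "lean_set \<Gamma> A" "generated \<Gamma> A = generated \<Gamma> B"
  shows "A \<subseteq> B"
proof
  fix a
  assume a: "a \<in> A"
  then have "a \<in> generated \<Gamma> B"
    using subset_generated[OF assms(2)] assms(4) by blast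
  then obtain b g where b: "a = b + g" "b \<in> B" "g \<in> \<Gamma>"
    by (auto simp: generated_def)
  then have "b \<in> generated \<Gamma> A"
    using subset_generated[OF assms(2)] assms(4) by blast
  then obtain a' g' where a': "b = a' + g'" "a' \<in> A" "g' \<in> \<Gamma>"
    by (auto simp: generated_def)
  then have "g' + g = 0"
    using a b assms(1) by (intro lean_setD[OF assms(3), of a']) (auto simp: add.assoc)
  then show "a \<in> B"
    using b by simp
qed

definition minimal_generators :: "nat set \<Rightarrow> nat set \<Rightarrow> nat set" where
  "minimal_generators \<Gamma> \<Delta> = {x \<in> \<Delta>. \<forall>y\<in>\<Delta>. \<forall>g\<in>\<Gamma>. x = y + g \<longrightarrow> g = 0}"

text \<open>Finiteness holds because two minimal generators congruent modulo m would differ by a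
  multiple of m, which lies in \<Gamma>; so each residue class contains at most one.\<close>

lemma lean_set_minimal_generators:
  assumes "semimodule \<Gamma> \<Delta>" "0 \<in> \<Delta>" "m > 0" "\<And>k. k * m \<in> \<Gamma>"
  shows "lean_set \<Gamma> (minimal_generators \<Gamma> \<Delta>)"
proof -
  let ?A = "minimal_generators \<Gamma> \<Delta>"
  have eq: "x = y" if "x \<in> ?A" "y \<in> ?A" "x \<le> y" "y - x \<in> \<Gamma>" for x y
  proof -
    have "y = x + (y - x)" "x \<in> \<Delta>"
      using that by (simp_all add: minimal_generators_def)
    then have "y - x = 0"
      using that(2,4) unfolding minimal_generators_def by blast
    then show ?thesis
      using that(3) by simp
  qed
  have "inj_on (\<lambda>x. x mod m) ?A"
  proof (rule linorder_inj_onI')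
    fix x y
    assume xy: "x \<in> ?A" "y \<in> ?A" "x < y"
    show "x mod m \<noteq> y mod m"
    proof
      assume "x mod m = y mod m"
      then obtain k where "y - x = m * k"
        using mod_eq_dvd_iff_nat[of x y m] xy(3) by (auto elim!: dvdE)
      then show False
        using eq[of x y] xy assms(4)[of k] by (simp add: mult.commute)
    qed
  qed
  moreover have "finite ((\<lambda>x. x mod m) ` ?A)"
    using assms(3) by (auto intro!: finite_subset[OF _ finite_lessThan[of m]])
  ultimately have "finite ?A"
    using finite_image_iff by blast
  moreover have "0 \<in> ?A"
    using assms(2) by (auto simp: minimal_generators_def)
  moreover have "nat \<bar>int x - int y\<bar> \<notin> \<Gamma>" if "x \<in> ?A" "y \<in> ?A" "x \<noteq> y" for x y
  proof (cases "x \<le> y")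
    case True
    then have "nat \<bar>int x - int y\<bar> = y - x" by simp
    then show ?thesis using eq[of x y] that True by auto
  next
    case False
    then have "nat \<bar>int x - int y\<bar> = x - y" by simp
    then show ?thesis using eq[of y x] that False by auto
  qed
  ultimately show ?thesis
    by (simp add: lean_set_def)
qed

text \<open>An element that is not minimal is y + g with a smaller y in \<Delta>; this descent ends
  at a minimal generator.\<close>

lemma generated_minimal_generators:
  assumes "\<And>g h. g \<in> \<Gamma> \<Longrightarrow> h \<in> \<Gamma> \<Longrightarrow> g + h \<in> \<Gamma>" "0 \<in> \<Gamma>" "semimodule \<Gamma> \<Delta>"
  shows "generated \<Gamma> (minimal_generators \<Gamma> \<Delta>) = \<Delta>"
proof (intro equalityI subsetI)
  fix x
  assume "x \<in> \<Delta>"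
  then show "x \<in> generated \<Gamma> (minimal_generators \<Gamma> \<Delta>)"
  proof (induction x rule: less_induct)
    case (less x)
    show ?case
    proof (cases "x \<in> minimal_generators \<Gamma> \<Delta>")
      case True
      then show ?thesis
        using subset_generated[OF assms(2)] by blast
    next
      case False
      then obtain y g where y: "y \<in> \<Delta>" "g \<in> \<Gamma>" "x = y + g" "g \<noteq> 0"
        using less.prems by (auto simp: minimal_generators_def)
      then obtain a h where "y = a + h" "a \<in> minimal_generators \<Gamma> \<Delta>" "h \<in> \<Gamma>"
        using less.IH[of y] by (auto simp: generated_def)
      then show ?thesis
        using y assms(1) by (auto simp: generated_def add.assoc)
    qed
  qed
qed (use generated_subset[OF assms(3), of "minimal_generators \<Gamma> \<Delta>"] in
    \<open>auto simp: minimal_generators_def\<close>)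

lemma card_lean_sets:
  assumes "\<And>g h. g \<in> \<Gamma> \<Longrightarrow> h \<in> \<Gamma> \<Longrightarrow> g + h \<in> \<Gamma>" "m > 0" "\<And>k. k * m \<in> \<Gamma>"
  shows "card {A. lean_set \<Gamma> A} = card {\<Delta>. semimodule \<Gamma> \<Delta> \<and> 0 \<in> \<Delta>}"
proof -
  have zero: "0 \<in> \<Gamma>"
    using assms(3)[of 0] by simp
  have "bij_betw (generated \<Gamma>) {A. lean_set \<Gamma> A} {\<Delta>. semimodule \<Gamma> \<Delta> \<and> 0 \<in> \<Delta>}"
  proof (rule bij_betw_imageI)
    show "inj_on (generated \<Gamma>) {A. lean_set \<Gamma> A}"
      by (rule inj_onI) (use generated_lean_subset[OF assms(1) zero] in blast)
    show "generated \<Gamma> ` {A. lean_set \<Gamma> A} = {\<Delta>. semimodule \<Gamma> \<Delta> \<and> 0 \<in> \<Delta>}"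
    proof (intro equalityI subsetI)
      fix \<Delta>
      assume "\<Delta> \<in> generated \<Gamma> ` {A. lean_set \<Gamma> A}"
      then obtain A where A: "\<Delta> = generated \<Gamma> A" "0 \<in> A"
        by (auto simp: lean_set_def)
      then show "\<Delta> \<in> {\<Delta>. semimodule \<Gamma> \<Delta> \<and> 0 \<in> \<Delta>}"
        using semimodule_generated[OF assms(1), of A] subset_generated[OF zero, of A] zero by auto
    next
      fix \<Delta>
      assume "\<Delta> \<in> {\<Delta>. semimodule \<Gamma> \<Delta> \<and> 0 \<in> \<Delta>}"
      then have \<Delta>: "semimodule \<Gamma> \<Delta>" "0 \<in> \<Delta>"
        by auto
      have "generated \<Gamma> (minimal_generators \<Gamma> \<Delta>) = \<Delta>"
        by (rule generated_minimal_generators[OF assms(1) zero \<Delta>(1)])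
      then show "\<Delta> \<in> generated \<Gamma> ` {A. lean_set \<Gamma> A}"
        using lean_set_minimal_generators[OF \<Delta> assms(2,3)] by blast
    qed
  qed
  then show ?thesis
    by (rule bij_betw_same_card)
qed


section \<open>Semimodules of ballot words\<close>

lemma gen_semigroup_add:
  assumes "g \<in> gen_semigroup \<alpha> \<beta>" "h \<in> gen_semigroup \<alpha> \<beta>"
  shows "g + h \<in> gen_semigroup \<alpha> \<beta>"
proof -
  obtain a b c d where "g = a * \<alpha> + b * \<beta>" "h = c * \<alpha> + d * \<beta>"
    using assms by (auto simp: gen_semigroup_def)
  then have "g + h = (a + c) * \<alpha> + (b + d) * \<beta>"
    by (simp add: algebra_simps)
  then show ?thesis
    unfolding gen_semigroup_def by blast
qed

lemma multiple_in_gen_semigroup: "k * \<alpha> \<in> gen_semigroup \<alpha> \<beta>" "k * \<beta> \<in> gen_semigroup \<alpha> \<beta>"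
proof -
  have "k * \<alpha> = k * \<alpha> + 0 * \<beta>" "k * \<beta> = 0 * \<alpha> + k * \<beta>"
    by simp_all
  then show "k * \<alpha> \<in> gen_semigroup \<alpha> \<beta>" "k * \<beta> \<in> gen_semigroup \<alpha> \<beta>"
    unfolding gen_semigroup_def by blast+
qed

lemma zero_in_gen_semigroup: "0 \<in> gen_semigroup \<alpha> \<beta>"
  using multiple_in_gen_semigroup(1)[of 0] by simp

text \<open>Closure under \<Gamma> read in the integers, where the weights live.\<close>

lemma semimodule_add_int:
  "semimodule \<Gamma> \<Delta> \<Longrightarrow> x \<in> int ` \<Delta> \<Longrightarrow> g \<in> \<Gamma> \<Longrightarrow> x + int g \<in> int ` \<Delta>"
  unfolding semimodule_def by (auto simp flip: of_nat_add)

text \<open>On ballot words \<open>nat\<close> loses nothing, as their prefix weights are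
  nonnegative.\<close>

definition word_semimodule :: "nat \<Rightarrow> nat \<Rightarrow> bool list \<Rightarrow> nat set" where
  "word_semimodule \<alpha> \<beta> w =
    generated (gen_semigroup \<alpha> \<beta>) (range (\<lambda>k. nat (weight \<alpha> \<beta> (take k w))))"

lemma word_semimodule_normalized:
  "semimodule (gen_semigroup \<alpha> \<beta>) (word_semimodule \<alpha> \<beta> w)" "0 \<in> word_semimodule \<alpha> \<beta> w"
proof -
  show "semimodule (gen_semigroup \<alpha> \<beta>) (word_semimodule \<alpha> \<beta> w)"
    unfolding word_semimodule_def
    using gen_semigroup_add zero_in_gen_semigroup by (intro semimodule_generated) blast+
  have "nat (weight \<alpha> \<beta> (take 0 w)) \<in> word_semimodule \<alpha> \<beta> w"
    unfolding word_semimodule_def by (rule subsetD[OF subset_generated[OF zero_in_gen_semigroup]]) blast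
  then show "0 \<in> word_semimodule \<alpha> \<beta> w"
    by simp
qed

lemma weight_take_in_word_semimodule:
  assumes "w \<in> ballot_words \<alpha> \<beta>"
  shows "weight \<alpha> \<beta> (take k w) \<in> int ` word_semimodule \<alpha> \<beta> w"
proof -
  have "nat (weight \<alpha> \<beta> (take k w)) \<in> word_semimodule \<alpha> \<beta> w"
    unfolding word_semimodule_def by (rule subsetD[OF subset_generated[OF zero_in_gen_semigroup]]) blast
  moreover have "0 \<le> weight \<alpha> \<beta> (take k w)"
    using assms by (simp add: ballot_words_def)
  ultimately show ?thesis
    by (metis image_eqI int_nat_eq)
qed

lemma count_list_take_mono: "i \<le> j \<Longrightarrow> count_list (take i w) b \<le> count_list (take j w) b"
  by (metis count_list_append le_add1 le_add_diff_inverse take_add)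

lemma count_list_take_le: "count_list (take i w) b \<le> count_list w b"
  by (metis append_take_drop_id count_list_append le_add1)

text \<open>This recovers a step from the semimodule. A step to the right reaches the label
  decreased by \<alpha>, which is a generator. For a step down, that smaller label lies strictly
  outside the path and no label on the path generates it.\<close>

lemma word_semimodule_step_iff:
  assumes "coprime \<alpha> \<beta>" "\<alpha> > 0" "w \<in> ballot_words \<alpha> \<beta>" "k < length w"
  shows "w ! k \<longleftrightarrow> weight \<alpha> \<beta> (take k w) - int \<alpha> \<notin> int ` word_semimodule \<alpha> \<beta> w"
proof (cases "w ! k")
  case False
  then have "weight \<alpha> \<beta> (take (Suc k) w) = weight \<alpha> \<beta> (take k w) - int \<alpha>"
    using assms(4) by (simp add: take_Suc_conv_app_nth) (simp add: weight_def)
  then show ?thesis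
    using False weight_take_in_word_semimodule[OF assms(3), of "Suc k"] by simp
next
  case True
  define D R where "D = (\<lambda>i. int (count_list (take i w) True))"
    and "R = (\<lambda>i. int (count_list (take i w) False))"
  have weight: "weight \<alpha> \<beta> (take i w) = int \<beta> * D i - int \<alpha> * R i" for i
    by (simp add: weight_def D_def R_def)
  have D_Suc: "D (Suc k) = D k + 1"
    using True assms(4) by (simp add: D_def take_Suc_conv_app_nth)
  have bounds: "0 \<le> D i" "D i \<le> int \<alpha>" "0 \<le> R i" "R i \<le> int \<beta>" for i
    using assms(3) count_list_take_le[of i w]
    by (auto simp: D_def R_def ballot_words_def step_words_def)
  have False if out: "weight \<alpha> \<beta> (take k w) - int \<alpha> \<in> int ` word_semimodule \<alpha> \<beta> w"
  proof -
    obtain j a b where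
      "weight \<alpha> \<beta> (take k w) - int \<alpha> = int (nat (weight \<alpha> \<beta> (take j w)) + (a * \<alpha> + b * \<beta>))"
      using out by (auto simp: word_semimodule_def generated_def gen_semigroup_def)
    moreover have "0 \<le> weight \<alpha> \<beta> (take j w)"
      using assms(3) by (simp add: ballot_words_def)
    ultimately have eq: "int \<beta> * (D j - D k + int b) = int \<alpha> * (R j - R k - (int a + 1))"
      by (simp add: weight algebra_simps)
    then have "int \<alpha> dvd int \<beta> * (D j - D k + int b)"
      by simp
    then have "int \<alpha> dvd D j - D k + int b"
      using assms(1) by (simp add: coprime_dvd_mult_right_iff)
    \<comment> \<open>By coprimality, the displacement from point k to point j is known up to a
      multiple c of the full period of \<alpha> steps down and \<beta> to the right.\<close>
    then obtain c where c: "D j - D k + int b = int \<alpha> * c" ..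
    then have "int \<alpha> * (int \<beta> * c) = int \<alpha> * (R j - R k - (int a + 1))"
      using eq by (simp add: mult.left_commute)
    then have R: "R j - R k = int \<beta> * c + int a + 1"
      using assms(2) by simp
    consider "c \<ge> 1" | "c \<le> -1" | "c = 0"
      by linarith
    then show False
    proof cases
      \<comment> \<open>More than \<beta> steps to the right would be needed.\<close>
      case 1
      then have "int \<beta> * 1 \<le> int \<beta> * c"
        by (intro mult_left_mono) auto
      then show False
        using R bounds(4)[of j] bounds(3)[of k] by linarith
    next
      \<comment> \<open>\<open>D k\<close> would be at least \<alpha>, but the step down after it
        leaves room for at most \<alpha> - 1.\<close>
      case 2
      then have "int \<alpha> * c \<le> int \<alpha> * (-1)"
        by (intro mult_left_mono) auto
      then show False
        using c bounds(1)[of j] bounds(2)[of "Suc k"] D_Suc by linarith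
    next
      \<comment> \<open>Point j lies further right, hence comes after the step down at k, yet would
        have to be no lower than point k.\<close>
      case 3
      then have "R j > R k"
        using R by simp
      then have "\<not> j \<le> k"
        using count_list_take_mono[of j k w False] by (auto simp: R_def)
      then have "D (Suc k) \<le> D j"
        using count_list_take_mono[of "Suc k" j w True] by (simp add: D_def)
      then show False
        using c 3 D_Suc by simp
    qed
  qed
  then show ?thesis
    using True by blast
qed

text \<open>By \<open>word_semimodule_step_iff\<close> each letter is determined by the semimodule
  and the prefix before it.\<close>

lemma inj_on_word_semimodule:
  assumes "coprime \<alpha> \<beta>" "\<alpha> > 0"
  shows "inj_on (word_semimodule \<alpha> \<beta>) (ballot_words \<alpha> \<beta>)"
proof (rule inj_onI)
  fix v w
  assume v: "v \<in> ballot_words \<alpha> \<beta>" and w: "w \<in> ballot_words \<alpha> \<beta>"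
    and eq: "word_semimodule \<alpha> \<beta> v = word_semimodule \<alpha> \<beta> w"
  have len: "length v = \<alpha> + \<beta>" "length w = \<alpha> + \<beta>"
    using v w by (auto simp: ballot_words_def length_step_words)
  have "take k v = take k w" if "k \<le> \<alpha> + \<beta>" for k
    using that
  proof (induction k)
    case (Suc k)
    then have IH: "take k v = take k w" and k: "k < length v" "k < length w"
      using len by auto
    have "v ! k = w ! k"
      using word_semimodule_step_iff[OF assms v k(1)] word_semimodule_step_iff[OF assms w k(2)] IH eq
      by simp
    then show ?case
      using IH k by (simp add: take_Suc_conv_app_nth)
  qed simp
  then show "v = w"
    using len by (metis order_refl take_all_iff)
qed

section \<open>The boundary walk of a semimodule\<close>

text \<open>The criterion of \<open>word_semimodule_step_iff\<close>, turned into a recursion for an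
  arbitrary \<Delta>.\<close>

primrec greedy_word :: "nat \<Rightarrow> nat \<Rightarrow> nat set \<Rightarrow> nat \<Rightarrow> bool list" where
  "greedy_word \<alpha> \<beta> \<Delta> 0 = []"
| "greedy_word \<alpha> \<beta> \<Delta> (Suc k) = greedy_word \<alpha> \<beta> \<Delta> k @
    [weight \<alpha> \<beta> (greedy_word \<alpha> \<beta> \<Delta> k) - int \<alpha> \<notin> int ` \<Delta>]"

lemma length_greedy_word [simp]: "length (greedy_word \<alpha> \<beta> \<Delta> k) = k"
  by (induction k) auto

lemma take_greedy_word: "take j (greedy_word \<alpha> \<beta> \<Delta> k) = greedy_word \<alpha> \<beta> \<Delta> (min j k)"
  by (induction k) (auto simp: min_def le_Suc_eq)

lemma nth_greedy_word:
  "j < k \<Longrightarrow> greedy_word \<alpha> \<beta> \<Delta> k ! j \<longleftrightarrow>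
    weight \<alpha> \<beta> (greedy_word \<alpha> \<beta> \<Delta> j) - int \<alpha> \<notin> int ` \<Delta>"
  by (induction k) (auto simp: nth_append less_Suc_eq)

text \<open>A step to the right is taken only if it stays in \<Delta>, and a step down adds \<beta>,
  an element of the semigroup.\<close>

lemma weight_greedy_word:
  assumes "semimodule (gen_semigroup \<alpha> \<beta>) \<Delta>" "0 \<in> \<Delta>"
  shows "weight \<alpha> \<beta> (greedy_word \<alpha> \<beta> \<Delta> k) \<in> int ` \<Delta>"
proof (induction k)
  case 0
  then show ?case
    using imageI[OF assms(2), of int] by simp
next
  case (Suc k)
  then have "weight \<alpha> \<beta> (greedy_word \<alpha> \<beta> \<Delta> k) + int (1 * \<beta>) \<in> int ` \<Delta>"
    by (rule semimodule_add_int[OF assms(1) _ multiple_in_gen_semigroup(2)])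
  moreover have "weight \<alpha> \<beta> [b] = (if b then int \<beta> else - int \<alpha>)" for b
    by (simp add: weight_def)
  ultimately show ?case
    by simp
qed

text \<open>After \<alpha> steps down the label is a multiple of \<alpha>, and so is the one to its
  right. The latter lies in \<Delta> because 0 does, so no further step down is taken.\<close>

lemma count_list_greedy_word_le:
  assumes "semimodule (gen_semigroup \<alpha> \<beta>) \<Delta>" "0 \<in> \<Delta>" "k \<le> \<alpha> + \<beta>"
  shows "count_list (greedy_word \<alpha> \<beta> \<Delta> k) True \<le> \<alpha>"
  using assms(3)
proof (induction k)
  case (Suc k)
  let ?u = "greedy_word \<alpha> \<beta> \<Delta> k"
  show ?case
  proof (cases "count_list ?u True = \<alpha>")
    case True
    define f where "f = count_list ?u False"
    \<comment> \<open>At least one of the \<alpha> + \<beta> steps remains, so the label to the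
      right is still nonnegative.\<close>
    have "Suc f \<le> \<beta>"
      using count_list_True_False[of ?u] True Suc.prems by (simp add: f_def)
    then obtain e where e: "\<beta> = Suc f + e"
      using le_Suc_ex by blast
    have "weight \<alpha> \<beta> ?u = int \<beta> * int \<alpha> - int \<alpha> * int f"
      by (simp add: weight_def f_def True)
    also have "int \<beta> = int f + 1 + int e"
      using arg_cong[OF e, of int] by simp
    finally have "weight \<alpha> \<beta> ?u - int \<alpha> = int 0 + int (e * \<alpha>)"
      by (simp add: algebra_simps)
    also have "\<dots> \<in> int ` \<Delta>"
      by (rule semimodule_add_int[OF assms(1) imageI[OF assms(2)] multiple_in_gen_semigroup(1)])
    finally show ?thesis
      using True by simp
  next
    case False
    then show ?thesis
      using Suc by simp
  qed
qed simp

text \<open>At most \<alpha> steps go down, so at least \<beta> go right; the final weight, being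
  nonnegative, then forces equality in both.\<close>

lemma greedy_word_in_ballot_words:
  assumes "semimodule (gen_semigroup \<alpha> \<beta>) \<Delta>" "0 \<in> \<Delta>" "\<beta> > 0"
  shows "greedy_word \<alpha> \<beta> \<Delta> (\<alpha> + \<beta>) \<in> ballot_words \<alpha> \<beta>"
proof -
  let ?w = "greedy_word \<alpha> \<beta> \<Delta> (\<alpha> + \<beta>)"
  have nonneg: "0 \<le> weight \<alpha> \<beta> (take k ?w)" for k
    using weight_greedy_word[OF assms(1,2), of "min k (\<alpha> + \<beta>)"] by (auto simp: take_greedy_word)
  have le: "count_list ?w True \<le> \<alpha>"
    using count_list_greedy_word_le[OF assms(1,2)] by simp
  have sum: "count_list ?w True + count_list ?w False = \<alpha> + \<beta>"
    using count_list_True_False[of ?w] by simp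
  have "\<alpha> * \<beta> \<le> \<alpha> * count_list ?w False"
    using le sum by (intro mult_left_mono) auto
  also have "\<dots> \<le> \<beta> * count_list ?w True"
    using nonneg[of "\<alpha> + \<beta>"] by (simp add: weight_def flip: of_nat_mult)
  finally have "\<alpha> \<le> count_list ?w True"
    using assms(3) by (simp add: mult.commute)
  then show ?thesis
    using le sum nonneg by (simp add: ballot_words_def step_words_def)
qed

text \<open>With b = \<open>True\<close> this selects the step down that leaves the row reached
  after d such steps.\<close>

lemma ex_nth_count_list_take:
  "d < count_list w b \<Longrightarrow> \<exists>k<length w. w ! k = b \<and> count_list (take k w) b = d"
proof (induction w rule: rev_induct)
  case (snoc c w)
  show ?case
  proof (cases "d < count_list w b")
    case True
    then obtain k where "k < length w" "w ! k = b" "count_list (take k w) b = d"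
      using snoc.IH by blast
    then show ?thesis
      by (intro exI[of _ k]) (simp add: nth_append)
  next
    case False
    then have "c = b" "d = count_list w b"
      using snoc.prems by (auto split: if_splits)
    then show ?thesis
      by (intro exI[of _ "length w"]) simp
  qed
qed simp

text \<open>The multiples 0, \<beta>, ..., (\<alpha> - 1) \<beta> cover all residues modulo
  \<alpha>; d is x times the inverse of \<beta>, reduced modulo \<alpha>.\<close>

lemma coprime_ex_residue:
  assumes "coprime \<alpha> \<beta>" "\<alpha> > 0"
  shows "\<exists>d<\<alpha>. int \<alpha> dvd int x - int \<beta> * int d"
proof -
  obtain y where "[\<beta> * y = 1] (mod \<alpha>)"
    using cong_solve_coprime_nat[of \<beta> \<alpha>] assms(1) by (auto simp: coprime_commute)
  then have "[\<beta> * y * x = 1 * x] (mod \<alpha>)"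
    by (rule cong_scalar_right)
  moreover have "[\<beta> * (y * x mod \<alpha>) = \<beta> * (y * x)] (mod \<alpha>)"
    by (simp add: cong_def mod_mult_right_eq)
  ultimately have "[x = \<beta> * (y * x mod \<alpha>)] (mod \<alpha>)"
    by (simp add: mult.assoc cong_def)
  then have "int \<alpha> dvd int x - int (\<beta> * (y * x mod \<alpha>))"
    by (metis cong_iff_dvd_diff cong_int_iff)
  then show ?thesis
    using assms(2) by (intro exI[of _ "y * x mod \<alpha>"]) simp
qed

text \<open>All labels of the walk lie in \<Delta>. Conversely, the labels at its steps down
  represent all residues modulo \<alpha>, and each is the least element of \<Delta> in its class, so
  every x in \<Delta> is such a label plus a multiple of \<alpha>.\<close>

lemma word_semimodule_greedy_word:
  assumes "coprime \<alpha> \<beta>" "\<alpha> > 0" "\<beta> > 0" "semimodule (gen_semigroup \<alpha> \<beta>) \<Delta>" "0 \<in> \<Delta>"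
  shows "word_semimodule \<alpha> \<beta> (greedy_word \<alpha> \<beta> \<Delta> (\<alpha> + \<beta>)) = \<Delta>"
proof -
  let ?g = "greedy_word \<alpha> \<beta> \<Delta>" and ?n = "\<alpha> + \<beta>"
  have ballot: "?g ?n \<in> ballot_words \<alpha> \<beta>"
    using greedy_word_in_ballot_words assms(3-5) by blast
  show ?thesis
  proof (intro equalityI subsetI)
    have "nat (weight \<alpha> \<beta> (take k (?g ?n))) \<in> \<Delta>" for k
      using weight_greedy_word[OF assms(4,5), of "min k ?n"] by (auto simp: take_greedy_word)
    then have "range (\<lambda>k. nat (weight \<alpha> \<beta> (take k (?g ?n)))) \<subseteq> \<Delta>"
      by (rule image_subsetI)
    then have "word_semimodule \<alpha> \<beta> (?g ?n) \<subseteq> \<Delta>"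
      unfolding word_semimodule_def by (rule generated_subset[OF assms(4)])
    then show "x \<in> \<Delta>" if "x \<in> word_semimodule \<alpha> \<beta> (?g ?n)" for x
      using that by (rule subsetD)
  next
    fix x
    assume x: "x \<in> \<Delta>"
    obtain d where d: "d < \<alpha>" "int \<alpha> dvd int x - int \<beta> * int d"
      using coprime_ex_residue[OF assms(1,2)] by blast
    moreover have "count_list (?g ?n) True = \<alpha>"
      using ballot by (simp add: ballot_words_def step_words_def)
    ultimately obtain k where k: "k < ?n" "?g ?n ! k" "count_list (take k (?g ?n)) True = d"
      using ex_nth_count_list_take[of d "?g ?n" True] by auto
    let ?l = "weight \<alpha> \<beta> (?g k)"
    have down: "?l - int \<alpha> \<notin> int ` \<Delta>"
      using k by (simp add: nth_greedy_word)
    have "int x - ?l = int x - int \<beta> * int d + int \<alpha> * int (count_list (?g k) False)"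
      using k(1,3) by (simp add: weight_def take_greedy_word)
    also have "int \<alpha> dvd \<dots>"
      using d(2) by (intro dvd_add) simp_all
    finally have "int \<alpha> dvd int x - ?l" .
    then obtain q where q: "int x - ?l = int \<alpha> * q" ..
    \<comment> \<open>If q were negative, \<open>?l - int \<alpha>\<close> would be x plus the
      nonnegative multiple (-q - 1) \<alpha>, hence in \<Delta>, and the walk would have gone
      right.\<close>
    have "q \<ge> 0"
    proof (rule ccontr)
      assume "\<not> q \<ge> 0"
      then have "int (nat (- q - 1) * \<alpha>) = (- q - 1) * int \<alpha>"
        by simp
      then have "?l - int \<alpha> = int x + int (nat (- q - 1) * \<alpha>)"
        using q by (simp only: algebra_simps)
      also have "\<dots> \<in> int ` \<Delta>"
        by (rule semimodule_add_int[OF assms(4) imageI[OF x] multiple_in_gen_semigroup(1)])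
      finally show False
        using down by simp
    qed
    then have "int (nat q * \<alpha>) = int \<alpha> * q"
      by simp
    then have "int x = ?l + int (nat q * \<alpha>)"
      using q by linarith
    also have "\<dots> \<in> int ` word_semimodule \<alpha> \<beta> (?g ?n)"
      using weight_take_in_word_semimodule[OF ballot, of k] k(1)
      by (intro semimodule_add_int[OF word_semimodule_normalized(1) _ multiple_in_gen_semigroup(1)])
        (simp add: take_greedy_word)
    finally show "x \<in> word_semimodule \<alpha> \<beta> (?g ?n)"
      by auto
  qed
qed

lemma card_normalized_semimodules:
  assumes "coprime \<alpha> \<beta>" "\<alpha> > 0" "\<beta> > 0"
  shows "card {\<Delta>. semimodule (gen_semigroup \<alpha> \<beta>) \<Delta> \<and> 0 \<in> \<Delta>} = card (ballot_words \<alpha> \<beta>)"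
proof -
  have "word_semimodule \<alpha> \<beta> ` ballot_words \<alpha> \<beta> = {\<Delta>. semimodule (gen_semigroup \<alpha> \<beta>) \<Delta> \<and> 0 \<in> \<Delta>}"
  proof (intro equalityI subsetI)
    fix \<Delta>
    assume "\<Delta> \<in> {\<Delta>. semimodule (gen_semigroup \<alpha> \<beta>) \<Delta> \<and> 0 \<in> \<Delta>}"
    then have \<Delta>: "semimodule (gen_semigroup \<alpha> \<beta>) \<Delta>" "0 \<in> \<Delta>"
      by auto
    show "\<Delta> \<in> word_semimodule \<alpha> \<beta> ` ballot_words \<alpha> \<beta>"
      using imageI[OF greedy_word_in_ballot_words[OF \<Delta> assms(3)], of "word_semimodule \<alpha> \<beta>"]
      unfolding word_semimodule_greedy_word[OF assms \<Delta>] .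
  qed (use word_semimodule_normalized in auto)
  then show ?thesis
    using card_image[OF inj_on_word_semimodule[OF assms(1,2)]] by metis
qed

theorem theorem3p7:
  fixes \<alpha> \<beta> :: nat
  assumes "\<alpha> > 0" and "\<beta> > 0" and "coprime \<alpha> \<beta>"
  shows "real (card (semimodule_iso_classes (gen_semigroup \<alpha> \<beta>))) = L_total \<alpha> \<beta> \<and>
         real (card {A. lean_set (gen_semigroup \<alpha> \<beta>) A}) = L_total \<alpha> \<beta> \<and>
         real (card {ps. lattice_path (0, int \<alpha>) (int \<beta>, 0) ps \<and> below_diagonal \<alpha> \<beta> ps})
           = L_total \<alpha> \<beta> \<and>
         L_total \<alpha> \<beta> = 1 / real (\<alpha> + \<beta>) * real ((\<alpha> + \<beta>) choose \<alpha>)"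
proof -
  have closed: "L_total \<alpha> \<beta> = 1 / real (\<alpha> + \<beta>) * real ((\<alpha> + \<beta>) choose \<alpha>)"
    using L_total_closed_form assms(1,2) .
  have ballot: "real (card (ballot_words \<alpha> \<beta>)) = L_total \<alpha> \<beta>"
    unfolding closed card_ballot_words[OF assms(3,1), symmetric] using assms(1) by simp
  \<comment> \<open>The modulus m of \<open>card_lean_sets\<close> is taken to be \<alpha>.\<close>
  have "card {A. lean_set (gen_semigroup \<alpha> \<beta>) A} = card (ballot_words \<alpha> \<beta>)"
    using card_lean_sets[OF gen_semigroup_add assms(1) multiple_in_gen_semigroup(1)]
      card_normalized_semimodules[OF assms(3,1,2)] by simp
  then show ?thesis
    using closed ballot card_normalized_semimodules[OF assms(3,1,2)]
    by (simp add: card_semimodule_iso_classes card_lattice_paths_below)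
qed

end
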